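(* Let $\mathbf{C}$ be a preadditive category, let $A$ and $B$ be objects of $\mathbf{C}$ such that $A\prec B$, and let $I$ be a proper (two-sided) ideal of the ring $\operatorname{End}_{\mathbf{C}}(A)$. Then $\mathcal{A}_I(B,B)$ is a proper ideal of $\operatorname{End}_{\mathbf{C}}(B)$ which is not maximal.
   Context: A preadditive category is a category with an abelian group structure on each hom-set such that composition is bilinear. For objects $A,B$ of a preadditive category $\mathbf{C}$, write $A\prec B$ if there exists an infinite subset $E\subseteq \operatorname{Hom}_{\mathbf{C}}(B,A)\times\operatorname{Hom}_{\mathbf{C}}(A,B)$ such that (1) $fg=1_A$ for every $(f,g)\in E$; and (2) for each $\varphi\in\operatorname{Hom}_{\mathbf{C}}(A,B)$, $|\{(f,g)\in E: f\varphi\neq 0\}|<|E|$. Given an object $A$ of $\mathbf{C}$ and a two-sided ideal $I$ of $\operatorname{End}_{\mathbf{C}}(A)$, the ideal $\mathcal{A}_I$ of $\mathbf{C}$ associated to $I$ is defined, for objects $X,Y$ of $\mathbf{C}$, by $$\mathcal{A}_I(X,Y)=\{f\in\operatorname{Hom}_{\mathbf{C}}(X,Y): \beta f\alpha\in I \text{ for all } \alpha\in\operatorname{Hom}_{\mathbf{C}}(A,X) \text{ and } \beta\in\operatorname{Hom}_{\mathbf{C}}(Y,A)\}.$$ *)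

theory Defs
  imports "HOL-Algebra.Ideal"
begin

text \<open>
  Hom-sets are given as a family indexed by pairs of objects and need not be disjoint, so
  composition, addition and zero are indexed by objects as well: \<open>cmp C X Y Z g f\<close> is the
  composite \<open>g \<circ> f\<close> of \<open>f : X \<rightarrow> Y\<close> and \<open>g : Y \<rightarrow> Z\<close>.
\<close>

record ('o, 'm) preadd_cat =
  Ob :: "'o set"
  Hom :: "'o \<Rightarrow> 'o \<Rightarrow> 'm set"
  cmp :: "'o \<Rightarrow> 'o \<Rightarrow> 'o \<Rightarrow> 'm \<Rightarrow> 'm \<Rightarrow> 'm"
  ident :: "'o \<Rightarrow> 'm"
  hadd :: "'o \<Rightarrow> 'o \<Rightarrow> 'm \<Rightarrow> 'm \<Rightarrow> 'm"
  hzero :: "'o \<Rightarrow> 'o \<Rightarrow> 'm"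

definition hom_group :: "('o, 'm, 'c) preadd_cat_scheme \<Rightarrow> 'o \<Rightarrow> 'o \<Rightarrow> 'm monoid" where
  "hom_group C X Y = \<lparr>carrier = Hom C X Y, monoid.mult = hadd C X Y, one = hzero C X Y\<rparr>"

locale preadditive_category =
  fixes C :: "('o, 'm, 'c) preadd_cat_scheme"
  assumes cmp_closed: "\<lbrakk>X \<in> Ob C; Y \<in> Ob C; Z \<in> Ob C; f \<in> Hom C X Y; g \<in> Hom C Y Z\<rbrakk>
      \<Longrightarrow> cmp C X Y Z g f \<in> Hom C X Z"
    and ident_closed: "X \<in> Ob C \<Longrightarrow> ident C X \<in> Hom C X X"
    and cmp_assoc: "\<lbrakk>W \<in> Ob C; X \<in> Ob C; Y \<in> Ob C; Z \<in> Ob C;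
        f \<in> Hom C W X; g \<in> Hom C X Y; h \<in> Hom C Y Z\<rbrakk>
      \<Longrightarrow> cmp C W Y Z h (cmp C W X Y g f) = cmp C W X Z (cmp C X Y Z h g) f"
    and ident_left: "\<lbrakk>X \<in> Ob C; Y \<in> Ob C; f \<in> Hom C X Y\<rbrakk> \<Longrightarrow> cmp C X Y Y (ident C Y) f = f"
    and ident_right: "\<lbrakk>X \<in> Ob C; Y \<in> Ob C; f \<in> Hom C X Y\<rbrakk> \<Longrightarrow> cmp C X X Y f (ident C X) = f"
    and hom_comm_group: "\<lbrakk>X \<in> Ob C; Y \<in> Ob C\<rbrakk> \<Longrightarrow> comm_group (hom_group C X Y)"
    and cmp_hadd_left: "\<lbrakk>X \<in> Ob C; Y \<in> Ob C; Z \<in> Ob C;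
        f \<in> Hom C X Y; g \<in> Hom C Y Z; g' \<in> Hom C Y Z\<rbrakk>
      \<Longrightarrow> cmp C X Y Z (hadd C Y Z g g') f = hadd C X Z (cmp C X Y Z g f) (cmp C X Y Z g' f)"
    and cmp_hadd_right: "\<lbrakk>X \<in> Ob C; Y \<in> Ob C; Z \<in> Ob C;
        f \<in> Hom C X Y; f' \<in> Hom C X Y; g \<in> Hom C Y Z\<rbrakk>
      \<Longrightarrow> cmp C X Y Z g (hadd C X Y f f') = hadd C X Z (cmp C X Y Z g f) (cmp C X Y Z g f')"

definition End_ring :: "('o, 'm, 'c) preadd_cat_scheme \<Rightarrow> 'o \<Rightarrow> 'm ring" where
  "End_ring C X = \<lparr>carrier = Hom C X X, monoid.mult = cmp C X X X, one = ident C X,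
     zero = hzero C X X, add = hadd C X X\<rparr>"

lemma (in preadditive_category) End_ring_is_ring:
  assumes "X \<in> Ob C"
  shows "ring (End_ring C X)"
proof (rule ringI)
  have "add_monoid (End_ring C X) = hom_group C X X"
    by (simp add: End_ring_def hom_group_def)
  then show "abelian_group (End_ring C X)"
    using hom_comm_group[OF assms assms]
    by (intro abelian_group.intro abelian_monoid.intro abelian_group_axioms.intro)
      (simp_all add: comm_group.axioms)
  show "Group.monoid (End_ring C X)"
    by (rule monoidI)
      (use assms in \<open>simp_all add: End_ring_def cmp_closed ident_closed cmp_assoc
        ident_left ident_right\<close>)
qed (use assms in \<open>simp_all add: End_ring_def cmp_hadd_left cmp_hadd_right\<close>)

context
  includes cardinal_syntax
begin

definition obj_prec :: "('o, 'm, 'c) preadd_cat_scheme \<Rightarrow> 'o \<Rightarrow> 'o \<Rightarrow> bool" where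
  "obj_prec C A B \<longleftrightarrow>
     (\<exists>E. E \<subseteq> Hom C B A \<times> Hom C A B \<and> infinite E \<and>
        (\<forall>(f, g) \<in> E. cmp C A B A f g = ident C A) \<and>
        (\<forall>\<phi> \<in> Hom C A B. |{(f, g) \<in> E. cmp C A B A f \<phi> \<noteq> hzero C A A}| <o |E| ))"

end

definition assoc_ideal ::
    "('o, 'm, 'c) preadd_cat_scheme \<Rightarrow> 'o \<Rightarrow> 'm set \<Rightarrow> 'o \<Rightarrow> 'o \<Rightarrow> 'm set" where
  "assoc_ideal C A I X Y =
     {f \<in> Hom C X Y. \<forall>\<alpha> \<in> Hom C A X. \<forall>\<beta> \<in> Hom C Y A.
        cmp C A Y A \<beta> (cmp C A X Y f \<alpha>) \<in> I}"

end

theory Submission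
  imports Defs
begin

text \<open>
  Let \<open>E\<close> witness \<open>A \<prec> B\<close> and let \<open>J\<close> be the ideal associated to \<open>I\<close>. Any \<open>(f, g) \<in> E\<close> gives
  \<open>f g = 1 \<notin> I\<close>, so \<open>1 \<notin> J\<close>. Strictly between \<open>J\<close> and \<open>End B\<close> lies the ideal \<open>K\<close> of those \<open>k\<close> such
  that, for every \<open>t\<close>, only fewer than \<open>|E|\<close> pairs \<open>(f, g) \<in> E\<close> have \<open>f t k \<alpha> \<notin> I\<close> for some \<open>\<alpha>\<close>;
  it is closed under addition because \<open>|E|\<close> is infinite. Taking \<open>t = 1\<close> and \<open>\<alpha> = g\<close> shows \<open>1 \<notin> K\<close>.
  For \<open>(f, g) \<in> E\<close> the idempotent \<open>g f\<close> is not in \<open>J\<close>, as \<open>f (g f) g = 1\<close>, but it is in \<open>K\<close> since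
  \<open>f' t g = 0\<close> for all but fewer than \<open>|E|\<close> pairs \<open>(f', g')\<close>.
\<close>

text \<open>Closure under negation follows from left absorption, since
  \<open>\<ominus> a = (\<ominus> \<one>) \<otimes> a\<close>. For the ideals below, only sums and
  products then have to be checked.\<close>

lemma (in ring) idealI_mult_closed:
  assumes sub: "J \<subseteq> carrier R" and ne: "J \<noteq> {}"
    and add: "\<And>a b. \<lbrakk>a \<in> J; b \<in> J\<rbrakk> \<Longrightarrow> a \<oplus> b \<in> J"
    and left: "\<And>a x. \<lbrakk>a \<in> J; x \<in> carrier R\<rbrakk> \<Longrightarrow> x \<otimes> a \<in> J"
    and right: "\<And>a x. \<lbrakk>a \<in> J; x \<in> carrier R\<rbrakk> \<Longrightarrow> a \<otimes> x \<in> J"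
  shows "ideal J R"
proof (rule idealI[OF ring_axioms])
  have "\<ominus> a \<in> J" if "a \<in> J" for a
  proof -
    have "\<ominus> a = (\<ominus> \<one>) \<otimes> a"
      using that sub l_minus[of \<one> a] by auto
    then show ?thesis
      using left[OF that, of "\<ominus> \<one>"] by simp
  qed
  then show "subgroup J (add_monoid R)"
    using sub ne add by (intro add.subgroupI) auto
qed (use left right in auto)

section \<open>Zero morphisms and the associated ideal\<close>

context preadditive_category
begin

lemma hzero_closed:
  assumes "X \<in> Ob C" "Y \<in> Ob C"
  shows "hzero C X Y \<in> Hom C X Y"
proof -
  interpret G: comm_group "hom_group C X Y"
    by (rule hom_comm_group[OF assms])
  show ?thesis
    using G.one_closed by (simp add: hom_group_def)
qed

lemma hadd_closed:
  assumes "X \<in> Ob C" "Y \<in> Ob C" "f \<in> Hom C X Y" "g \<in> Hom C X Y"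
  shows "hadd C X Y f g \<in> Hom C X Y"
proof -
  interpret G: comm_group "hom_group C X Y"
    by (rule hom_comm_group[OF assms(1,2)])
  show ?thesis
    using G.m_closed[of f g] assms by (simp add: hom_group_def)
qed

lemma hadd_hzero:
  assumes "X \<in> Ob C" "Y \<in> Ob C"
  shows "hadd C X Y (hzero C X Y) (hzero C X Y) = hzero C X Y"
proof -
  interpret G: comm_group "hom_group C X Y"
    by (rule hom_comm_group[OF assms])
  show ?thesis
    using G.l_one[OF G.one_closed] by (simp add: hom_group_def)
qed

text \<open>Cancellation in the hom-group. By \<open>0 + 0 = 0\<close> and bilinearity, a composite
  with a zero morphism equals its own double, so this makes it zero.\<close>

lemma hadd_self_imp_hzero:
  assumes "X \<in> Ob C" "Y \<in> Ob C" "f \<in> Hom C X Y" "hadd C X Y f f = f"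
  shows "f = hzero C X Y"
proof -
  interpret G: comm_group "hom_group C X Y"
    by (rule hom_comm_group[OF assms(1,2)])
  show ?thesis
    using G.r_cancel_one[of f f] assms by (simp add: hom_group_def)
qed

lemma cmp_hzero_left:
  assumes "X \<in> Ob C" "Y \<in> Ob C" "Z \<in> Ob C" "f \<in> Hom C X Y"
  shows "cmp C X Y Z (hzero C Y Z) f = hzero C X Z"
  using assms cmp_hadd_left[of X Y Z f "hzero C Y Z" "hzero C Y Z"]
  by (intro hadd_self_imp_hzero) (simp_all add: hzero_closed hadd_hzero cmp_closed)

lemma cmp_hzero_right:
  assumes "X \<in> Ob C" "Y \<in> Ob C" "Z \<in> Ob C" "g \<in> Hom C Y Z"
  shows "cmp C X Y Z g (hzero C X Y) = hzero C X Z"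
  using assms cmp_hadd_right[of X Y Z "hzero C X Y" "hzero C X Y" g]
  by (intro hadd_self_imp_hzero) (simp_all add: hzero_closed hadd_hzero cmp_closed)

lemma ideal_hadd_closed:
  assumes "ideal I (End_ring C A)" "x \<in> I" "y \<in> I"
  shows "hadd C A A x y \<in> I"
  using additive_subgroup.a_closed[OF ideal.axioms(1)[OF assms(1)] assms(2,3)]
  by (simp add: End_ring_def)

lemma ideal_hzero_closed:
  assumes "ideal I (End_ring C A)"
  shows "hzero C A A \<in> I"
  using additive_subgroup.zero_closed[OF ideal.axioms(1)[OF assms]]
  by (simp add: End_ring_def)

lemma ideal_ident_notin:
  assumes "ideal I (End_ring C A)" "I \<noteq> carrier (End_ring C A)"
  shows "ident C A \<notin> I"
  using ideal.one_imp_carrier[OF assms(1)] assms(2) by (auto simp: End_ring_def)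

text \<open>A factor on the left is absorbed into the test morphism \<open>\<beta>\<close>, a factor
  on the right into \<open>\<alpha>\<close>; sums are handled by bilinearity and closure of
  \<open>I\<close> under addition.\<close>

lemma assoc_ideal_is_ideal:
  assumes A: "A \<in> Ob C" and B: "B \<in> Ob C" and I: "ideal I (End_ring C A)"
  shows "ideal (assoc_ideal C A I B B) (End_ring C B)"
proof -
  interpret R: ring "End_ring C B"
    by (rule End_ring_is_ring[OF B])
  show ?thesis
  proof (rule R.idealI_mult_closed)
    show "assoc_ideal C A I B B \<subseteq> carrier (End_ring C B)"
      by (auto simp: assoc_ideal_def End_ring_def)
    have "hzero C B B \<in> assoc_ideal C A I B B"
      using A B ideal_hzero_closed[OF I]
      by (simp add: assoc_ideal_def hzero_closed cmp_hzero_left cmp_hzero_right)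
    then show "assoc_ideal C A I B B \<noteq> {}"
      by blast
  next
    fix a b
    assume "a \<in> assoc_ideal C A I B B" "b \<in> assoc_ideal C A I B B"
    then show "a \<oplus>\<^bsub>End_ring C B\<^esub> b \<in> assoc_ideal C A I B B"
      using A B ideal_hadd_closed[OF I]
      by (simp add: assoc_ideal_def End_ring_def hadd_closed cmp_hadd_left cmp_hadd_right cmp_closed)
  next
    fix a x
    assume a: "a \<in> assoc_ideal C A I B B" and x: "x \<in> carrier (End_ring C B)"
    have aH: "a \<in> Hom C B B" and xH: "x \<in> Hom C B B"
      using a x by (auto simp: assoc_ideal_def End_ring_def)
    have "cmp C A B A \<beta> (cmp C A B B (cmp C B B B x a) \<alpha>) \<in> I"
      if "\<alpha> \<in> Hom C A B" "\<beta> \<in> Hom C B A" for \<alpha> \<beta>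
    proof -
      have "cmp C A B A \<beta> (cmp C A B B (cmp C B B B x a) \<alpha>)
          = cmp C A B A \<beta> (cmp C A B B x (cmp C A B B a \<alpha>))"
        using A B aH xH that by (simp add: cmp_assoc)
      also have "\<dots> = cmp C A B A (cmp C B B A \<beta> x) (cmp C A B B a \<alpha>)"
        using A B aH xH that by (intro cmp_assoc) (simp_all add: cmp_closed)
      finally show ?thesis
        using a A B xH that by (simp add: assoc_ideal_def cmp_closed)
    qed
    then show "x \<otimes>\<^bsub>End_ring C B\<^esub> a \<in> assoc_ideal C A I B B"
      using B aH xH by (simp add: assoc_ideal_def End_ring_def cmp_closed)
    have "cmp C A B A \<beta> (cmp C A B B (cmp C B B B a x) \<alpha>) \<in> I"
      if "\<alpha> \<in> Hom C A B" "\<beta> \<in> Hom C B A" for \<alpha> \<beta>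
      using a A B aH xH that cmp_assoc[of A B B B \<alpha> x a, symmetric]
      by (simp add: assoc_ideal_def cmp_closed)
    then show "a \<otimes>\<^bsub>End_ring C B\<^esub> x \<in> assoc_ideal C A I B B"
      using B aH xH by (simp add: assoc_ideal_def End_ring_def cmp_closed)
  qed
qed

end

section \<open>The intermediate ideal\<close>

context
  includes cardinal_syntax
begin

text \<open>The exceptional pairs, whose first component detects \<open>t \<circ> k\<close> modulo
  \<open>I\<close>. The parameter \<open>t\<close> makes room for left multiplication of
  \<open>k\<close>, as \<open>\<alpha>\<close> does for right multiplication.\<close>

definition large_set ::
    "('o, 'm, 'c) preadd_cat_scheme \<Rightarrow> 'o \<Rightarrow> 'o \<Rightarrow> ('m \<times> 'm) set \<Rightarrow> 'm set \<Rightarrow> 'm \<Rightarrow> 'm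
      \<Rightarrow> ('m \<times> 'm) set" where
  "large_set C A B E I t k =
     {(f, g) \<in> E. \<exists>\<alpha> \<in> Hom C A B. cmp C A B A f (cmp C A B B t (cmp C A B B k \<alpha>)) \<notin> I}"

definition small_ideal ::
    "('o, 'm, 'c) preadd_cat_scheme \<Rightarrow> 'o \<Rightarrow> 'o \<Rightarrow> ('m \<times> 'm) set \<Rightarrow> 'm set \<Rightarrow> 'm set" where
  "small_ideal C A B E I =
     {k \<in> Hom C B B. \<forall>t \<in> Hom C B B. |large_set C A B E I t k| <o |E|}"

end

context preadditive_category
begin

context
  includes cardinal_syntax
  fixes A B :: 'o and I :: "'m set" and E :: "('m \<times> 'm) set"
  assumes A: "A \<in> Ob C" and B: "B \<in> Ob C" and I: "ideal I (End_ring C A)"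
    and E: "E \<subseteq> Hom C B A \<times> Hom C A B" and inf: "infinite E"
begin

text \<open>For \<open>k\<close> in the associated ideal there are no exceptional pairs at all:
  \<open>f \<circ> t\<close> is one of the morphisms \<open>\<beta>\<close> against which
  \<open>k\<close> is tested.\<close>

lemma assoc_ideal_subset_small_ideal: "assoc_ideal C A I B B \<subseteq> small_ideal C A B E I"
proof
  fix k
  assume k: "k \<in> assoc_ideal C A I B B"
  then have kH: "k \<in> Hom C B B"
    by (simp add: assoc_ideal_def)
  have "large_set C A B E I t k = {}" if t: "t \<in> Hom C B B" for t
  proof -
    have "cmp C A B A f (cmp C A B B t (cmp C A B B k \<alpha>)) \<in> I"
      if "(f, g) \<in> E" "\<alpha> \<in> Hom C A B" for f g \<alpha>
    proof -
      have f: "f \<in> Hom C B A"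
        using that E by auto
      have "cmp C A B A f (cmp C A B B t (cmp C A B B k \<alpha>))
          = cmp C A B A (cmp C B B A f t) (cmp C A B B k \<alpha>)"
        using A B f t kH that by (intro cmp_assoc) (simp_all add: cmp_closed)
      then show ?thesis
        using k A B f t that by (simp add: assoc_ideal_def cmp_closed)
    qed
    then show ?thesis
      by (auto simp: large_set_def)
  qed
  \<comment> \<open>The inequality is strict because \<open>E\<close>, being infinite, is
    nonempty.\<close>
  moreover have "|{} :: ('m \<times> 'm) set| <o |E|"
    using inf card_of_ordLess2[of E "{} :: ('m \<times> 'm) set"] by auto
  ultimately show "k \<in> small_ideal C A B E I"
    using kH by (simp add: small_ideal_def)
qed

lemma small_ideal_is_ideal: "ideal (small_ideal C A B E I) (End_ring C B)"
proof -
  interpret R: ring "End_ring C B"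
    by (rule End_ring_is_ring[OF B])
  show ?thesis
  proof (rule R.idealI_mult_closed)
    show "small_ideal C A B E I \<subseteq> carrier (End_ring C B)"
      by (auto simp: small_ideal_def End_ring_def)
    interpret J: ideal "assoc_ideal C A I B B" "End_ring C B"
      by (rule assoc_ideal_is_ideal[OF A B I])
    show "small_ideal C A B E I \<noteq> {}"
      using J.zero_closed assoc_ideal_subset_small_ideal by blast
  next
    fix a b
    assume a: "a \<in> small_ideal C A B E I" and b: "b \<in> small_ideal C A B E I"
    have aH: "a \<in> Hom C B B" and bH: "b \<in> Hom C B B"
      using a b by (auto simp: small_ideal_def)
    have "|large_set C A B E I t (hadd C B B a b)| <o |E|" if t: "t \<in> Hom C B B" for t
    proof -
      have dist: "cmp C A B A f (cmp C A B B t (cmp C A B B (hadd C B B a b) \<alpha>))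
          = hadd C A A (cmp C A B A f (cmp C A B B t (cmp C A B B a \<alpha>)))
             (cmp C A B A f (cmp C A B B t (cmp C A B B b \<alpha>)))"
        if "f \<in> Hom C B A" "\<alpha> \<in> Hom C A B" for f \<alpha>
        using A B aH bH t that by (simp add: cmp_hadd_left cmp_hadd_right cmp_closed)
      \<comment> \<open>If a sum lies outside \<open>I\<close>, so does one of its two
        summands.\<close>
      have "large_set C A B E I t (hadd C B B a b)
          \<subseteq> large_set C A B E I t a \<union> large_set C A B E I t b"
      proof
        fix p
        assume "p \<in> large_set C A B E I t (hadd C B B a b)"
        then obtain f g \<alpha> where p: "p = (f, g)" "(f, g) \<in> E" and \<alpha>: "\<alpha> \<in> Hom C A B"
          and notin: "cmp C A B A f (cmp C A B B t (cmp C A B B (hadd C B B a b) \<alpha>)) \<notin> I"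
          by (auto simp: large_set_def)
        have "cmp C A B A f (cmp C A B B t (cmp C A B B a \<alpha>)) \<notin> I
            \<or> cmp C A B A f (cmp C A B B t (cmp C A B B b \<alpha>)) \<notin> I"
          using notin p(2) E \<alpha> dist[of f \<alpha>] ideal_hadd_closed[OF I] by auto
        then show "p \<in> large_set C A B E I t a \<union> large_set C A B E I t b"
          using p \<alpha> by (auto simp: large_set_def)
      qed
      \<comment> \<open>Two sets of cardinality below an infinite cardinal have a union below
        it.\<close>
      moreover have "|large_set C A B E I t a \<union> large_set C A B E I t b| <o |E|"
        using a b t inf by (intro card_of_Un_ordLess_infinite) (auto simp: small_ideal_def)
      ultimately show ?thesis
        by (rule ordLeq_ordLess_trans[OF card_of_mono1])
    qed
    then show "a \<oplus>\<^bsub>End_ring C B\<^esub> b \<in> small_ideal C A B E I"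
      using B aH bH by (simp add: small_ideal_def End_ring_def hadd_closed)
  next
    fix a x
    assume a: "a \<in> small_ideal C A B E I" and x: "x \<in> carrier (End_ring C B)"
    have aH: "a \<in> Hom C B B" and xH: "x \<in> Hom C B B"
      using a x by (auto simp: small_ideal_def End_ring_def)
    \<comment> \<open>Left multiplication by \<open>x\<close> only changes the parameter from
      \<open>t\<close> to \<open>t \<circ> x\<close>.\<close>
    have "large_set C A B E I t (cmp C B B B x a) = large_set C A B E I (cmp C B B B t x) a"
      if "t \<in> Hom C B B" for t
    proof -
      have "cmp C A B B t (cmp C A B B (cmp C B B B x a) \<alpha>)
          = cmp C A B B (cmp C B B B t x) (cmp C A B B a \<alpha>)" if "\<alpha> \<in> Hom C A B" for \<alpha>
        using A B aH xH \<open>t \<in> Hom C B B\<close> that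
          cmp_assoc[of A B B B \<alpha> a x] cmp_assoc[of A B B B "cmp C A B B a \<alpha>" x t]
        by (simp add: cmp_closed)
      then show ?thesis
        by (auto simp: large_set_def)
    qed
    then show "x \<otimes>\<^bsub>End_ring C B\<^esub> a \<in> small_ideal C A B E I"
      using a B aH xH by (simp add: small_ideal_def End_ring_def cmp_closed)
    \<comment> \<open>Right multiplication by \<open>x\<close> restricts the witnesses to those of
      the form \<open>x \<circ> \<alpha>\<close>, hence an inclusion.\<close>
    have "large_set C A B E I t (cmp C B B B a x) \<subseteq> large_set C A B E I t a" for t
    proof -
      have "cmp C A B B (cmp C B B B a x) \<alpha> = cmp C A B B a (cmp C A B B x \<alpha>)"
        if "\<alpha> \<in> Hom C A B" for \<alpha>
        using A B aH xH that by (simp add: cmp_assoc)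
      moreover have "cmp C A B B x \<alpha> \<in> Hom C A B" if "\<alpha> \<in> Hom C A B" for \<alpha>
        using A B xH that by (simp add: cmp_closed)
      ultimately show ?thesis
        unfolding large_set_def by auto
    qed
    then have "|large_set C A B E I t (cmp C B B B a x)| <o |E|" if "t \<in> Hom C B B" for t
      by (rule ordLeq_ordLess_trans[OF card_of_mono1]) (use a that in \<open>auto simp: small_ideal_def\<close>)
    then show "a \<otimes>\<^bsub>End_ring C B\<^esub> x \<in> small_ideal C A B E I"
      using B aH xH by (simp add: small_ideal_def End_ring_def cmp_closed)
  qed
qed

lemma ident_notin_small_ideal:
  assumes one: "\<forall>(f, g) \<in> E. cmp C A B A f g = ident C A" and notin: "ident C A \<notin> I"
  shows "ident C B \<notin> small_ideal C A B E I"
proof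
  assume "ident C B \<in> small_ideal C A B E I"
  then have "|large_set C A B E I (ident C B) (ident C B)| <o |E|"
    using B by (simp add: small_ideal_def ident_closed)
  \<comment> \<open>Each pair supplies its own witness \<open>\<alpha> = g\<close>, so every pair is
    exceptional and the bound becomes \<open>|E| <o |E|\<close>.\<close>
  moreover have "large_set C A B E I (ident C B) (ident C B) = E"
  proof -
    have "g \<in> Hom C A B \<and>
        cmp C A B A f (cmp C A B B (ident C B) (cmp C A B B (ident C B) g)) \<notin> I"
      if "(f, g) \<in> E" for f g
    proof -
      have "g \<in> Hom C A B" "cmp C A B A f g = ident C A"
        using that E one by auto
      then show ?thesis
        using A B notin by (simp add: ident_left)
    qed
    then show ?thesis
      unfolding large_set_def by blast
  qed
  ultimately show False
    using ordLess_irreflexive by metis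
qed

text \<open>Any endomorphism factoring through \<open>A\<close> qualifies. Regrouping
  \<open>f t (u v) \<alpha>\<close> as \<open>(f (t u)) (v \<alpha>)\<close> shows that a pair is
  exceptional only if \<open>f (t u)\<close> is nonzero, and \<open>small\<close> at
  \<open>\<phi> = t u\<close> bounds the number of such pairs.\<close>

lemma cmp_in_small_ideal:
  assumes small: "\<forall>\<phi> \<in> Hom C A B. |{(f, g) \<in> E. cmp C A B A f \<phi> \<noteq> hzero C A A}| <o |E|"
    and u: "u \<in> Hom C A B" and v: "v \<in> Hom C B A"
  shows "cmp C B A B u v \<in> small_ideal C A B E I"
proof -
  have "|large_set C A B E I t (cmp C B A B u v)| <o |E|" if t: "t \<in> Hom C B B" for t
  proof -
    have "cmp C A B A f (cmp C A B B t (cmp C A B B (cmp C B A B u v) \<alpha>))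
        = cmp C A A A (cmp C A B A f (cmp C A B B t u)) (cmp C A B A v \<alpha>)"
      if "f \<in> Hom C B A" "\<alpha> \<in> Hom C A B" for f \<alpha>
    proof -
      have "cmp C A B B (cmp C B A B u v) \<alpha> = cmp C A A B u (cmp C A B A v \<alpha>)"
        using A B u v that by (simp add: cmp_assoc)
      moreover have "cmp C A B B t (cmp C A A B u (cmp C A B A v \<alpha>))
          = cmp C A A B (cmp C A B B t u) (cmp C A B A v \<alpha>)"
        using A B u v t that by (intro cmp_assoc) (simp_all add: cmp_closed)
      moreover have "cmp C A B A f (cmp C A A B (cmp C A B B t u) (cmp C A B A v \<alpha>))
          = cmp C A A A (cmp C A B A f (cmp C A B B t u)) (cmp C A B A v \<alpha>)"
        using A B u v t that by (intro cmp_assoc) (simp_all add: cmp_closed)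
      ultimately show ?thesis
        by simp
    qed
    moreover have "cmp C A A A (hzero C A A) (cmp C A B A v \<alpha>) \<in> I" if "\<alpha> \<in> Hom C A B" for \<alpha>
      using A B v that ideal_hzero_closed[OF I] by (simp add: cmp_hzero_left cmp_closed)
    ultimately have "large_set C A B E I t (cmp C B A B u v)
        \<subseteq> {(f, g) \<in> E. cmp C A B A f (cmp C A B B t u) \<noteq> hzero C A A}"
      using E unfolding large_set_def by auto
    moreover have "|{(f, g) \<in> E. cmp C A B A f (cmp C A B B t u) \<noteq> hzero C A A}| <o |E|"
      using small A B t u by (simp add: cmp_closed)
    ultimately show ?thesis
      by (rule ordLeq_ordLess_trans[OF card_of_mono1])
  qed
  then show ?thesis
    using A B u v by (simp add: small_ideal_def cmp_closed)
qed

end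

end

section \<open>Properness and failure of maximality\<close>

theorem theorem3p1:
  fixes C :: "('o, 'm) preadd_cat" and A B :: 'o and I :: "'m set"
  assumes "preadditive_category C"
    and "A \<in> Ob C" and "B \<in> Ob C"
    and "obj_prec C A B"
    and "ideal I (End_ring C A)" and "I \<noteq> carrier (End_ring C A)"
  shows "ideal (assoc_ideal C A I B B) (End_ring C B)
    \<and> assoc_ideal C A I B B \<noteq> carrier (End_ring C B)
    \<and> \<not> maximalideal (assoc_ideal C A I B B) (End_ring C B)"
proof -
  interpret preadditive_category C
    by fact
  note A = assms(2) and B = assms(3) and I = assms(5)
  obtain E where E: "E \<subseteq> Hom C B A \<times> Hom C A B" and inf: "infinite E"
    and one: "\<forall>(f, g) \<in> E. cmp C A B A f g = ident C A"
    and small: "\<forall>\<phi> \<in> Hom C A B.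
      (card_of {(f, g) \<in> E. cmp C A B A f \<phi> \<noteq> hzero C A A}, card_of E) \<in> ordLess"
    using assms(4) unfolding obj_prec_def by blast
  let ?J = "assoc_ideal C A I B B" and ?K = "small_ideal C A B E I"
  have notin: "ident C A \<notin> I"
    by (rule ideal_ident_notin[OF I assms(6)])
  have JK: "?J \<subseteq> ?K"
    by (rule assoc_ideal_subset_small_ideal[OF A B I E inf])
  have K: "ideal ?K (End_ring C B)"
    by (rule small_ideal_is_ideal[OF A B I E inf])
  have one_K: "ident C B \<notin> ?K"
    by (rule ident_notin_small_ideal[OF A B I E inf one notin])
  have one_R: "ident C B \<in> carrier (End_ring C B)"
    using B by (simp add: End_ring_def ident_closed)
  obtain f g where fg: "(f, g) \<in> E"
    using inf by (metis finite.emptyI ex_in_conv surj_pair)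
  then have f: "f \<in> Hom C B A" and g: "g \<in> Hom C A B" and fg1: "cmp C A B A f g = ident C A"
    using E one by auto
  \<comment> \<open>Testing \<open>g f\<close> with \<open>\<alpha> = g\<close> and
    \<open>\<beta> = f\<close> yields the identity, which is outside \<open>I\<close>.\<close>
  have "cmp C A B A f (cmp C A B B (cmp C B A B g f) g) = ident C A"
    using A B f g fg1 cmp_assoc[of A B A B g f g, symmetric]
    by (simp add: ident_right)
  then have "cmp C B A B g f \<notin> ?J"
    using f g notin unfolding assoc_ideal_def by force
  moreover have "cmp C B A B g f \<in> ?K"
    by (rule cmp_in_small_ideal[OF A B I E inf small g f])
  ultimately have "?K \<noteq> ?J"
    by blast
  moreover have "?K \<subseteq> carrier (End_ring C B)" "?K \<noteq> carrier (End_ring C B)"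
    using one_K one_R by (auto simp: small_ideal_def End_ring_def)
  \<comment> \<open>Maximality of \<open>?J\<close> would force \<open>?K\<close> to be
    \<open>?J\<close> or the whole ring, and both are excluded.\<close>
  ultimately have "\<not> maximalideal ?J (End_ring C B)"
    using maximalideal.I_maximal[OF _ K JK] by blast
  \<comment> \<open>Properness is inherited from the larger ideal \<open>?K\<close>, which omits the
    identity.\<close>
  moreover have "?J \<noteq> carrier (End_ring C B)"
    using JK one_K one_R by blast
  ultimately show ?thesis
    using assoc_ideal_is_ideal[OF A B I] by blast
qed

end
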